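(* (1) Let $\mathcal{A}\in\mathbb{C}_t^{m,n}$ be partitioned into row blocks $\mathcal{A}=\begin{pmatrix}\mathcal{A}_1\\ \mathcal{A}_2\end{pmatrix}$, and let $\mathcal{A}_1\{1\}_k$ be the set of all order $k$ $\{1\}$ inverses of $\mathcal{A}_1$. If $\mathcal{A}_2=0$, then $$\mathcal{A}\{1\}_k=\left\{\begin{pmatrix}\mathcal{W}&\mathcal{X}\end{pmatrix}\in\mathbb{C}_k^{n,m}\ \middle|\ \mathcal{W}\in\mathcal{A}_1\{1\}_k,\ \mathcal{X}\text{ is a tensor of suitable size with arbitrary entries}\right\},$$ where $\begin{pmatrix}\mathcal{W}&\mathcal{X}\end{pmatrix}$ is a partition into column blocks. (2) Let $\mathcal{A}\in\mathbb{C}_t^{m,n}$ be partitioned into column blocks $\mathcal{A}=\begin{pmatrix}\mathcal{A}_1&\mathcal{A}_2\end{pmatrix}$, and let $\mathcal{A}_1\{1\}_k$ be the set of all order $k$ $\{1\}$ inverses of $\mathcal{A}_1$. If $\mathcal{A}_2=0$, then $$\mathcal{A}\{1\}_k=\left\{\begin{pmatrix}\mathcal{W}\\ \mathcal{Y}\end{pmatrix}\in\mathbb{C}_k^{n,m}\ \middle|\ \mathcal{W}\in\mathcal{A}_1\{1\}_k,\ \mathcal{Y}\text{ is a tensor of suitable size with arbitrary entries}\right\},$$ where $\begin{pmatrix}\mathcal{W}\\ \mathcal{Y}\end{pmatrix}$ is a partition into row blocks.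
   Context: $[n]=\{1,\ldots,n\}$. $\mathbb{C}_{t}^{m,n}$ is the set of all order $t$ complex tensors $\mathcal{A}=(a_{i_1\cdots i_t})$ of dimension $m\times n\times\cdots\times n$ ($i_1\in[m]$, $i_2,\ldots,i_t\in[n]$). For $x\in\mathbb{C}^n$, $\mathcal{A}\cdot x^{t-1}\in\mathbb{C}^m$ has components $(\mathcal{A}\cdot x^{t-1})_i=\sum_{i_2,\ldots,i_t\in[n]}a_{ii_2\cdots i_t}x_{i_2}\cdots x_{i_t}$. For a vector $x$, $x^{[r]}=(x_1^r,\ldots,x_n^r)^{\mathrm T}$ (componentwise power; for $r=1/s$ this is the componentwise $s$-th root, no branch being specified in the paper). Row blocks: for a positive integer $r\le m$, $\mathcal{A}=\begin{pmatrix}\mathcal{A}_1\\ \mathcal{A}_2\end{pmatrix}$ where $\mathcal{A}_1=(a_{i_1\cdots i_t})$ with $i_1\le r$ (so $\mathcal{A}_1\in\mathbb{C}_t^{r,n}$) and $\mathcal{A}_2=(a_{i_1\cdots i_t})$ with $i_1>r$. Column blocks: for a positive integer $r\le n$, $\mathcal{A}=\begin{pmatrix}\mathcal{A}_1&\mathcal{A}_2\end{pmatrix}$ where $\mathcal{A}_1=(a_{i_1\cdots i_t})$ with $i_2,\ldots,i_t\le r$ (so $\mathcal{A}_1\in\mathbb{C}_t^{m,r}$) and $\mathcal{A}_2$ consists of all the other entries of $\mathcal{A}$ (those for which some $i_j>r$, $j\ge 2$). The order $k$ tensors in $\mathbb{C}_k^{n,m}$ are partitioned in the same way with the same $r$ (so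 $\mathcal{W}\in\mathbb{C}_k^{n,r}$ in (1) and $\mathcal{W}\in\mathbb{C}_k^{r,m}$ in (2)). General tensor product: for $\mathcal{A}\in\mathbb{C}_t^{m,n}$, $\mathcal{B}\in\mathbb{C}_k^{n,m}$, $\mathcal{A}\mathcal{B}\in\mathbb{C}_{(t-1)(k-1)+1}^{m,m}$ has entries $(\mathcal{A}\mathcal{B})_{i\alpha_1\cdots\alpha_{t-1}}=\sum_{i_2,\ldots,i_t\in[n]}a_{ii_2\cdots i_t}b_{i_2\alpha_1}\cdots b_{i_t\alpha_{t-1}}$, $i\in[m]$, $\alpha_1,\ldots,\alpha_{t-1}\in[m]^{k-1}$. $\mathcal{X}\in\mathbb{C}_k^{n,m}$ is an order $k$ $\{1\}$ inverse of $\mathcal{A}\in\mathbb{C}_t^{m,n}$ if $\mathcal{A}\mathcal{X}\cdot[(\mathcal{A}\cdot y^{t-1})^{[\frac1s]}]^s=\mathcal{A}\cdot y^{t-1}$ for all $y\in\mathbb{C}^n$, where $s=(t-1)(k-1)$. $\mathcal{A}\{1\}_k$ denotes the set of all order $k$ $\{1\}$ inverses of $\mathcal{A}$. *)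

theory Defs
  imports Complex_Main "HOL-Library.FuncSet"
begin

text \<open>
  Dimensions vary inside the statement, so tensors and vectors are extensional functions on
  explicit index sets: the entry at \<open>(i\<^sub>1, \<dots>, i\<^sub>t)\<close> is \<open>A (i\<^sub>1, [i\<^sub>2, \<dots>, i\<^sub>t])\<close>, and two tensors of
  the same format are equal as functions iff all their entries agree. Indices start at 1.
\<close>

type_synonym tensor = "nat \<times> nat list \<Rightarrow> complex"
type_synonym cvector = "nat \<Rightarrow> complex"

definition multi_idx :: "nat \<Rightarrow> nat \<Rightarrow> nat list set" where
  "multi_idx d n = {js. set js \<subseteq> {1..n} \<and> length js = d}"

definition tensor_idx :: "nat \<Rightarrow> nat \<Rightarrow> nat \<Rightarrow> (nat \<times> nat list) set" where
  "tensor_idx t m n = {1..m} \<times> multi_idx (t - 1) n"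

definition tensors :: "nat \<Rightarrow> nat \<Rightarrow> nat \<Rightarrow> tensor set" where
  "tensors t m n = tensor_idx t m n \<rightarrow>\<^sub>E UNIV"

definition cvectors :: "nat \<Rightarrow> cvector set" where
  "cvectors n = {1..n} \<rightarrow>\<^sub>E UNIV"

text \<open>The vector \<open>A \<cdot> x\<^sup>t\<^sup>-\<^sup>1\<close>, for \<open>A\<close> of order \<open>t\<close> and dimension \<open>m \<times> n \<times> \<dots> \<times> n\<close>.\<close>

definition tensor_apply :: "nat \<Rightarrow> nat \<Rightarrow> nat \<Rightarrow> tensor \<Rightarrow> cvector \<Rightarrow> cvector" where
  "tensor_apply t m n A x =
     (\<lambda>i\<in>{1..m}. \<Sum>js\<in>multi_idx (t - 1) n. A (i, js) * (\<Prod>l<t - 1. x (js ! l)))"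

text \<open>
  General product of \<open>A\<close> (order \<open>t\<close>, \<open>m \<times> n \<times> \<dots> \<times> n\<close>) and \<open>B\<close> (order \<open>k\<close>, \<open>n \<times> m \<times> \<dots> \<times> m\<close>).
  The multi-indices \<open>\<alpha>\<^sub>1, \<dots>, \<alpha>\<^sub>t\<^sub>-\<^sub>1\<close>, each of length \<open>k - 1\<close>, are concatenated into one list
  \<open>as\<close>; \<open>take (k - 1) (drop (l * (k - 1)) as)\<close> recovers the one in position \<open>l\<close>, counted from 0.
\<close>

definition tensor_mult :: "nat \<Rightarrow> nat \<Rightarrow> nat \<Rightarrow> nat \<Rightarrow> tensor \<Rightarrow> tensor \<Rightarrow> tensor" where
  "tensor_mult t k m n A B =
     restrict
       (\<lambda>(i, as). \<Sum>js\<in>multi_idx (t - 1) n.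
          A (i, js) * (\<Prod>l<t - 1. B (js ! l, take (k - 1) (drop (l * (k - 1)) as))))
       (tensor_idx ((t - 1) * (k - 1) + 1) m m)"

text \<open>
  The notation \<open>x\<^sup>[\<^sup>1\<^sup>/\<^sup>s\<^sup>]\<close> does not single out a branch of the \<open>s\<close>-th root. A choice of branches is
  therefore a parameter \<open>rt\<close>, where \<open>rt i\<close> is the branch used in component \<open>i\<close> (the same branch
  may, but need not, be used in all components).
\<close>

definition root_choice :: "nat \<Rightarrow> (nat \<Rightarrow> complex \<Rightarrow> complex) \<Rightarrow> bool" where
  "root_choice s rt \<longleftrightarrow> (\<forall>i c. rt i c ^ s = c)"

definition root_vec :: "(nat \<Rightarrow> complex \<Rightarrow> complex) \<Rightarrow> nat \<Rightarrow> cvector \<Rightarrow> cvector" where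
  "root_vec rt m x = (\<lambda>i\<in>{1..m}. rt i (x i))"

text \<open>The set of order \<open>k\<close> \<open>{1}\<close> inverses of \<open>A\<close> (order \<open>t\<close>, \<open>m \<times> n \<times> \<dots> \<times> n\<close>).\<close>

definition one_inverses ::
  "(nat \<Rightarrow> complex \<Rightarrow> complex) \<Rightarrow> nat \<Rightarrow> nat \<Rightarrow> nat \<Rightarrow> nat \<Rightarrow> tensor \<Rightarrow> tensor set" where
  "one_inverses rt k t m n A =
     {X \<in> tensors k n m. \<forall>y\<in>cvectors n.
        tensor_apply ((t - 1) * (k - 1) + 1) m m (tensor_mult t k m n A X)
          (root_vec rt m (tensor_apply t m n A y))
        = tensor_apply t m n A y}"

text \<open>
  Block partitions of a tensor of order \<open>t\<close> and dimension \<open>m \<times> n \<times> \<dots> \<times> n\<close>. The first block is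
  again a tensor; the second one is the family of all remaining entries, which keep their indices
  in the whole tensor.
\<close>

definition row_rest :: "nat \<Rightarrow> nat \<Rightarrow> nat \<Rightarrow> nat \<Rightarrow> (nat \<times> nat list) set" where
  "row_rest t m n r = {(i, js) \<in> tensor_idx t m n. r < i}"

definition row_block1 :: "nat \<Rightarrow> nat \<Rightarrow> nat \<Rightarrow> tensor \<Rightarrow> tensor" where
  "row_block1 t n r A = restrict A (tensor_idx t r n)"

definition row_block2 :: "nat \<Rightarrow> nat \<Rightarrow> nat \<Rightarrow> nat \<Rightarrow> tensor \<Rightarrow> tensor" where
  "row_block2 t m n r A = restrict A (row_rest t m n r)"

definition row_join :: "nat \<Rightarrow> nat \<Rightarrow> nat \<Rightarrow> nat \<Rightarrow> tensor \<Rightarrow> tensor \<Rightarrow> tensor" where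
  "row_join t m n r W Y = (\<lambda>p\<in>tensor_idx t m n. if p \<in> row_rest t m n r then Y p else W p)"

definition col_rest :: "nat \<Rightarrow> nat \<Rightarrow> nat \<Rightarrow> nat \<Rightarrow> (nat \<times> nat list) set" where
  "col_rest t m n r = {(i, js) \<in> tensor_idx t m n. \<exists>j\<in>set js. r < j}"

definition col_block1 :: "nat \<Rightarrow> nat \<Rightarrow> nat \<Rightarrow> tensor \<Rightarrow> tensor" where
  "col_block1 t m r A = restrict A (tensor_idx t m r)"

definition col_block2 :: "nat \<Rightarrow> nat \<Rightarrow> nat \<Rightarrow> nat \<Rightarrow> tensor \<Rightarrow> tensor" where
  "col_block2 t m n r A = restrict A (col_rest t m n r)"

definition col_join :: "nat \<Rightarrow> nat \<Rightarrow> nat \<Rightarrow> nat \<Rightarrow> tensor \<Rightarrow> tensor \<Rightarrow> tensor" where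
  "col_join t m n r W X = (\<lambda>p\<in>tensor_idx t m n. if p \<in> col_rest t m n r then X p else W p)"

end

theory Submission
  imports Defs
begin

text \<open>
  The general product satisfies \<open>(A X) \<cdot> u\<^sup>s = A \<cdot> (X \<cdot> u\<^sup>k\<^sup>-\<^sup>1)\<^sup>t\<^sup>-\<^sup>1\<close>, so \<open>X\<close> is a \<open>{1}\<close> inverse iff
  \<open>A \<cdot> (X \<cdot> u\<^sup>k\<^sup>-\<^sup>1)\<^sup>t\<^sup>-\<^sup>1 = A \<cdot> y\<^sup>t\<^sup>-\<^sup>1\<close> for every \<open>y\<close>, where \<open>u\<close> is the vector of roots of \<open>A \<cdot> y\<^sup>t\<^sup>-\<^sup>1\<close>.
  If the lower rows of \<open>A\<close> vanish, then so do the lower components of \<open>u\<close> (every branch of the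
  root maps 0 to 0), and \<open>X \<cdot> u\<^sup>k\<^sup>-\<^sup>1\<close> depends only on the first column block of \<open>X\<close>. If the
  right columns of \<open>A\<close> vanish, then \<open>A \<cdot> z\<^sup>t\<^sup>-\<^sup>1\<close> depends only on the first components of \<open>z\<close>, hence
  only the first row block of \<open>X\<close> matters.
\<close>

section \<open>Sums and products over multi-indices\<close>

lemma finite_multi_idx [simp]: "finite (multi_idx d n)"
  unfolding multi_idx_def by (rule finite_lists_length_eq) simp

lemma multi_idx_mono: "r \<le> n \<Longrightarrow> multi_idx d r \<subseteq> multi_idx d n"
  by (auto simp: multi_idx_def)

lemma multi_idx_nth: "js \<in> multi_idx d n \<Longrightarrow> l < d \<Longrightarrow> js ! l \<in> {1..n}"
  unfolding multi_idx_def using nth_mem by blast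

lemma sum_multi_idx_add:
  fixes g :: "nat list \<Rightarrow> 'a::comm_monoid_add"
  shows "sum g (multi_idx (a + b) m) = (\<Sum>bs\<in>multi_idx a m. \<Sum>cs\<in>multi_idx b m. g (bs @ cs))"
proof -
  have "sum g (multi_idx (a + b) m) =
      (\<Sum>(bs, cs)\<in>multi_idx a m \<times> multi_idx b m. g (bs @ cs))"
    by (rule sum.reindex_bij_witness
          [where i = "\<lambda>(bs, cs). bs @ cs" and j = "\<lambda>as. (take a as, drop a as)"])
       (auto simp: multi_idx_def dest: in_set_takeD in_set_dropD)
  then show ?thesis
    by (simp add: sum.cartesian_product)
qed

text \<open>Distributivity: expanding the product picks one multi-index of length e from each of the
  d factors. The d choices are stored as one concatenated list, the encoding used in
  \<open>tensor_mult\<close>.\<close>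

lemma prod_sum_multi_idx:
  fixes f :: "nat \<Rightarrow> nat list \<Rightarrow> 'a::comm_semiring_1"
  shows "(\<Prod>l<d. \<Sum>bs\<in>multi_idx e m. f l bs) =
    (\<Sum>as\<in>multi_idx (d * e) m. \<Prod>l<d. f l (take e (drop (l * e) as)))"
proof (induction d arbitrary: f)
  case 0
  have "multi_idx 0 m = {[]}"
    by (auto simp: multi_idx_def)
  then show ?case by simp
next
  case (Suc d)
  \<comment> \<open>Splitting off the first e entries shifts the chunk numbers by one, so the
    induction hypothesis is applied to \<open>f (Suc l)\<close>; hence
    \<open>arbitrary: f\<close>.\<close>
  have chunk: "(\<Prod>l<Suc d. f l (take e (drop (l * e) (bs @ cs)))) =
      f 0 bs * (\<Prod>l<d. f (Suc l) (take e (drop (l * e) cs)))"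
    if "bs \<in> multi_idx e m" for bs cs
    using that by (simp add: prod.lessThan_Suc_shift multi_idx_def del: prod.lessThan_Suc)
  have "(\<Prod>l<Suc d. \<Sum>bs\<in>multi_idx e m. f l bs) =
      (\<Sum>bs\<in>multi_idx e m. f 0 bs) *
      (\<Sum>cs\<in>multi_idx (d * e) m. \<Prod>l<d. f (Suc l) (take e (drop (l * e) cs)))"
    by (simp add: prod.lessThan_Suc_shift Suc.IH del: prod.lessThan_Suc)
  also have "\<dots> = (\<Sum>bs\<in>multi_idx e m. \<Sum>cs\<in>multi_idx (d * e) m.
      \<Prod>l<Suc d. f l (take e (drop (l * e) (bs @ cs))))"
    unfolding sum_product by (intro sum.cong refl chunk[symmetric])
  also have "\<dots> = (\<Sum>as\<in>multi_idx (Suc d * e) m. \<Prod>l<Suc d. f l (take e (drop (l * e) as)))"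
    by (simp add: sum_multi_idx_add del: prod.lessThan_Suc)
  finally show ?case .
qed

text \<open>Entry q of chunk l is entry q + l * e of the whole list, and by
  \<open>prod.nat_group\<close> these positions run once through all numbers below d * e.\<close>

lemma prod_chunks:
  fixes u :: "nat \<Rightarrow> 'a::comm_monoid_mult"
  shows "length as = d * e \<Longrightarrow>
    (\<Prod>l<d. \<Prod>q<e. u (take e (drop (l * e) as) ! q)) = (\<Prod>l<d * e. u (as ! l))"
proof -
  assume len: "length as = d * e"
  have "(\<Prod>q<e. u (take e (drop (l * e) as) ! q)) = (\<Prod>q<e. u (as ! (q + l * e)))" if "l < d" for l
  proof (rule prod.cong)
    have "l * e \<le> length as"
      using that len by simp
    then show "u (take e (drop (l * e) as) ! q) = u (as ! (q + l * e))" if "q \<in> {..<e}" for q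
      using that by (simp add: add.commute)
  qed simp
  then have "(\<Prod>l<d. \<Prod>q<e. u (take e (drop (l * e) as) ! q)) =
      (\<Prod>l<d. \<Prod>q<e. u (as ! (q + l * e)))"
    by simp
  also have "\<dots> = (\<Prod>l<d. \<Prod>q\<in>{l * e..<l * e + e}. u (as ! q))"
    using prod.shift_bounds_nat_ivl[of "\<lambda>q. u (as ! q)" 0 _ e]
    by (simp add: lessThan_atLeast0 add.commute[of e])
  also have "\<dots> = (\<Prod>l<d * e. u (as ! l))"
    by (rule prod.nat_group)
  finally show ?thesis .
qed

section \<open>Composition law for the general product\<close>

lemma tensor_apply_mult:
  "tensor_apply ((t - 1) * (k - 1) + 1) m m (tensor_mult t k m n A X) u =
   tensor_apply t m n A (tensor_apply k n m X u)"
proof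
  fix i
  define d e where "d = t - 1" and "e = k - 1"
  show "tensor_apply ((t - 1) * (k - 1) + 1) m m (tensor_mult t k m n A X) u i =
    tensor_apply t m n A (tensor_apply k n m X u) i"
  proof (cases "i \<in> {1..m}")
    case True
    let ?ch = "\<lambda>l as. take e (drop (l * e) as)"
    have "tensor_apply t m n A (tensor_apply k n m X u) i =
        (\<Sum>js\<in>multi_idx d n. A (i, js) *
          (\<Prod>l<d. \<Sum>bs\<in>multi_idx e m. X (js ! l, bs) * (\<Prod>q<e. u (bs ! q))))"
    proof -
      \<comment> \<open>Every \<open>js ! l\<close> lies in \<open>{1..n}\<close>, so the inner
        vector is evaluated only where it is given by its sum, never at
        \<open>undefined\<close>.\<close>
      have "(\<Prod>l<d. tensor_apply k n m X u (js ! l)) =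
          (\<Prod>l<d. \<Sum>bs\<in>multi_idx e m. X (js ! l, bs) * (\<Prod>q<e. u (bs ! q)))"
        if "js \<in> multi_idx d n" for js
        using multi_idx_nth[OF that]
        by (intro prod.cong refl) (simp add: tensor_apply_def e_def)
      then show ?thesis
        using True unfolding d_def[symmetric] tensor_apply_def[of t] by simp
    qed
    \<comment> \<open>The d sums over bs become one sum over as, and the d monomials in u merge into
      one of degree d * e.\<close>
    also have "\<dots> = (\<Sum>js\<in>multi_idx d n. \<Sum>as\<in>multi_idx (d * e) m.
        A (i, js) * (\<Prod>l<d. X (js ! l, ?ch l as)) * (\<Prod>l<d * e. u (as ! l)))"
      unfolding prod_sum_multi_idx sum_distrib_left
      by (intro sum.cong refl)
        (simp add: prod.distrib prod_chunks multi_idx_def mult.assoc del: take_drop nth_take nth_drop)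
    \<comment> \<open>With as outermost, the inner sum over js is the entry of the product at (i,
      as), times a monomial that does not involve js.\<close>
    also have "\<dots> = (\<Sum>as\<in>multi_idx (d * e) m. \<Sum>js\<in>multi_idx d n.
        A (i, js) * (\<Prod>l<d. X (js ! l, ?ch l as)) * (\<Prod>l<d * e. u (as ! l)))"
      by (rule sum.swap)
    also have "\<dots> = tensor_apply (d * e + 1) m m (tensor_mult t k m n A X) u i"
      using True unfolding tensor_apply_def tensor_mult_def tensor_idx_def
      by (auto simp: sum_distrib_right d_def e_def intro!: sum.cong)
    finally show ?thesis
      by (simp add: d_def e_def)
  qed (simp only: tensor_apply_def restrict_apply if_False)
qed

lemma one_inverses_iff:
  "X \<in> one_inverses rt k t m n A \<longleftrightarrow> X \<in> tensors k n m \<and>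
    (\<forall>y\<in>cvectors n. tensor_apply t m n A
        (tensor_apply k n m X (root_vec rt m (tensor_apply t m n A y))) = tensor_apply t m n A y)"
  by (simp only: one_inverses_def tensor_apply_mult mem_Collect_eq)

section \<open>Entries and components that \<open>tensor_apply\<close> reads\<close>

lemma tensor_apply_cong:
  assumes "\<And>j. j \<in> {1..n} \<Longrightarrow> x j = x' j"
  shows "tensor_apply t m n A x = tensor_apply t m n A x'"
  unfolding tensor_apply_def
proof (rule restrict_ext, rule sum.cong[OF refl])
  fix i js assume "js \<in> multi_idx (t - 1) n"
  then have "(\<Prod>l<t - 1. x (js ! l)) = (\<Prod>l<t - 1. x' (js ! l))"
    by (intro prod.cong refl assms multi_idx_nth) auto
  then show "A (i, js) * (\<Prod>l<t - 1. x (js ! l)) = A (i, js) * (\<Prod>l<t - 1. x' (js ! l))"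
    by simp
qed

text \<open>A multi-index over n that is not one over r has an entry beyond r. The hypothesis
  concerns the whole term because it serves two cases: the monomial in x vanishes (X applied to a
  root vector, for zero rows of A), or the tensor entry does (zero columns of A).\<close>

lemma tensor_apply_col_block1:
  assumes "r \<le> n"
    and "\<And>i js. i \<in> {1..m} \<Longrightarrow> js \<in> multi_idx (t - 1) n \<Longrightarrow> \<exists>j\<in>set js. r < j \<Longrightarrow>
      A (i, js) * (\<Prod>l<t - 1. x (js ! l)) = 0"
  shows "tensor_apply t m n A x = tensor_apply t m r (col_block1 t m r A) x"
  unfolding tensor_apply_def
proof (rule restrict_ext)
  fix i assume i: "i \<in> {1..m}"
  have "(\<Sum>js\<in>multi_idx (t - 1) n. A (i, js) * (\<Prod>l<t - 1. x (js ! l))) =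
      (\<Sum>js\<in>multi_idx (t - 1) r. A (i, js) * (\<Prod>l<t - 1. x (js ! l)))"
  proof (rule sum.mono_neutral_right)
    show "\<forall>js\<in>multi_idx (t - 1) n - multi_idx (t - 1) r. A (i, js) * (\<Prod>l<t - 1. x (js ! l)) = 0"
      using i by (intro ballI assms(2)) (fastforce simp: multi_idx_def)+
  qed (use assms(1) multi_idx_mono in auto)
  also have "\<dots> =
      (\<Sum>js\<in>multi_idx (t - 1) r. col_block1 t m r A (i, js) * (\<Prod>l<t - 1. x (js ! l)))"
    using i by (intro sum.cong) (auto simp: col_block1_def tensor_idx_def)
  finally show "(\<Sum>js\<in>multi_idx (t - 1) n. A (i, js) * (\<Prod>l<t - 1. x (js ! l))) =
      (\<Sum>js\<in>multi_idx (t - 1) r. col_block1 t m r A (i, js) * (\<Prod>l<t - 1. x (js ! l)))" .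
qed

lemma tensor_apply_row_block1:
  assumes "r \<le> m" "i \<in> {1..r}"
  shows "tensor_apply t m n A x i = tensor_apply t r n (row_block1 t n r A) x i"
  using assms by (auto simp: tensor_apply_def row_block1_def tensor_idx_def intro!: sum.cong)

lemma root_choice_zero: "root_choice s rt \<Longrightarrow> 0 < s \<Longrightarrow> rt i 0 = 0"
  by (metis root_choice_def power_eq_0_iff)

section \<open>Joins characterised by their first block\<close>

text \<open>The first block of a join is W again, because its indices avoid \<open>col_rest\<close>;
  conversely a tensor is the join of its own two blocks. Only a condition on the first block then
  remains to be proved.\<close>

lemma col_join_image:
  assumes "r \<le> m" "S \<subseteq> tensors k n r"
  shows "{col_join k n m r W X | W X. W \<in> S \<and> X \<in> col_rest k n m r \<rightarrow>\<^sub>E UNIV} =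
    {X \<in> tensors k n m. col_block1 k n r X \<in> S}"
proof (intro equalityI subsetI)
  have sub: "tensor_idx k n r \<subseteq> tensor_idx k n m - col_rest k n m r"
    using assms(1) by (fastforce simp: tensor_idx_def col_rest_def multi_idx_def)
  fix Z assume "Z \<in> {col_join k n m r W X | W X. W \<in> S \<and> X \<in> col_rest k n m r \<rightarrow>\<^sub>E UNIV}"
  then obtain W X where Z: "Z = col_join k n m r W X" and W: "W \<in> S"
    by blast
  have "col_block1 k n r (col_join k n m r W X) = W"
  proof
    fix p show "col_block1 k n r (col_join k n m r W X) p = W p"
      using sub W assms(2)
      by (cases "p \<in> tensor_idx k n r") (auto dest!: subsetD simp: col_block1_def col_join_def tensors_def)
  qed
  with W Z show "Z \<in> {X \<in> tensors k n m. col_block1 k n r X \<in> S}"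
    by (simp add: tensors_def col_join_def)
next
  fix X assume "X \<in> {X \<in> tensors k n m. col_block1 k n r X \<in> S}"
  then have X: "X \<in> tensors k n m" "col_block1 k n r X \<in> S"
    by auto
  have sub: "p \<in> tensor_idx k n r" if "p \<in> tensor_idx k n m" "p \<notin> col_rest k n m r" for p
    using that by (cases p) (auto simp: tensor_idx_def col_rest_def multi_idx_def subset_iff)
  have "X = col_join k n m r (col_block1 k n r X) (col_block2 k n m r X)"
  proof
    fix p show "X p = col_join k n m r (col_block1 k n r X) (col_block2 k n m r X) p"
      using sub[of p] X(1)
      by (cases p) (simp add: col_block1_def col_block2_def col_join_def tensors_def
          PiE_def extensional_def)
  qed
  moreover have "col_block2 k n m r X \<in> col_rest k n m r \<rightarrow>\<^sub>E UNIV"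
    by (simp add: col_block2_def)
  ultimately show "X \<in> {col_join k n m r W X | W X. W \<in> S \<and> X \<in> col_rest k n m r \<rightarrow>\<^sub>E UNIV}"
    using X(2) by blast
qed

lemma row_join_image:
  assumes "r \<le> n" "S \<subseteq> tensors k r m"
  shows "{row_join k n m r W Y | W Y. W \<in> S \<and> Y \<in> row_rest k n m r \<rightarrow>\<^sub>E UNIV} =
    {X \<in> tensors k n m. row_block1 k m r X \<in> S}"
proof (intro equalityI subsetI)
  have sub: "tensor_idx k r m \<subseteq> tensor_idx k n m - row_rest k n m r"
    using assms(1) by (auto simp: tensor_idx_def row_rest_def)
  fix Z assume "Z \<in> {row_join k n m r W Y | W Y. W \<in> S \<and> Y \<in> row_rest k n m r \<rightarrow>\<^sub>E UNIV}"
  then obtain W Y where Z: "Z = row_join k n m r W Y" and W: "W \<in> S"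
    by blast
  have "row_block1 k m r (row_join k n m r W Y) = W"
  proof
    fix p show "row_block1 k m r (row_join k n m r W Y) p = W p"
      using sub W assms(2)
      by (cases "p \<in> tensor_idx k r m") (auto dest!: subsetD simp: row_block1_def row_join_def tensors_def)
  qed
  with W Z show "Z \<in> {X \<in> tensors k n m. row_block1 k m r X \<in> S}"
    by (simp add: tensors_def row_join_def)
next
  fix X assume "X \<in> {X \<in> tensors k n m. row_block1 k m r X \<in> S}"
  then have X: "X \<in> tensors k n m" "row_block1 k m r X \<in> S"
    by auto
  have sub: "p \<in> tensor_idx k r m" if "p \<in> tensor_idx k n m" "p \<notin> row_rest k n m r" for p
    using that by (auto simp: tensor_idx_def row_rest_def)
  have "X = row_join k n m r (row_block1 k m r X) (row_block2 k n m r X)"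
  proof
    fix p show "X p = row_join k n m r (row_block1 k m r X) (row_block2 k n m r X) p"
      using sub[of p] X(1)
      by (cases p) (simp add: row_block1_def row_block2_def row_join_def tensors_def
          PiE_def extensional_def)
  qed
  moreover have "row_block2 k n m r X \<in> row_rest k n m r \<rightarrow>\<^sub>E UNIV"
    by (simp add: row_block2_def)
  ultimately show "X \<in> {row_join k n m r W Y | W Y. W \<in> S \<and> Y \<in> row_rest k n m r \<rightarrow>\<^sub>E UNIV}"
    using X(2) by blast
qed

section \<open>Reduction of the {1} condition to the first block\<close>

lemma one_inverses_subset: "one_inverses rt k t m n A \<subseteq> tensors k n m"
  by (auto simp: one_inverses_def)

lemma col_block1_tensors: "col_block1 k n r X \<in> tensors k n r"
  by (simp add: col_block1_def tensors_def)

lemma row_block1_tensors: "row_block1 k m r X \<in> tensors k r m"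
  by (simp add: row_block1_def tensors_def)

text \<open>Both conditions range over the same y in C^n and are matched for each y:
  \<open>eq_iff\<close> trades an equation of m-vectors for one of r-vectors, and X and its first
  column block send the respective root vectors to the same vector.\<close>

lemma one_inverses_zero_rows:
  assumes "r \<le> m" and zero: "row_block2 t m n r A = (\<lambda>p\<in>row_rest t m n r. 0)"
    and rt0: "\<And>i. rt i 0 = 0"
    and X: "X \<in> tensors k n m"
  shows "X \<in> one_inverses rt k t m n A \<longleftrightarrow>
    col_block1 k n r X \<in> one_inverses rt k t r n (row_block1 t n r A)"
proof -
  let ?A1 = "row_block1 t n r A" and ?X1 = "col_block1 k n r X"
  have A0: "A (i, js) = 0" if "i \<in> {1..m}" "r < i" "js \<in> multi_idx (t - 1) n" for i js
  proof -
    have "(i, js) \<in> row_rest t m n r"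
      using that by (simp add: row_rest_def tensor_idx_def)
    with fun_cong[OF zero, of "(i, js)"] show ?thesis
      by (simp add: row_block2_def)
  qed
  have Ax0: "tensor_apply t m n A x i = 0" if "i \<in> {1..m}" "r < i" for x i
    using that by (simp add: tensor_apply_def A0)
  \<comment> \<open>The first r components are the same on both sides of the equivalence; those from
    r + 1 to m are 0 for x and y alike, and all other values are \<open>undefined\<close>.\<close>
  have eq_iff: "tensor_apply t m n A x = tensor_apply t m n A y \<longleftrightarrow>
      tensor_apply t r n ?A1 x = tensor_apply t r n ?A1 y" for x y
  proof
    assume eq: "tensor_apply t m n A x = tensor_apply t m n A y"
    show "tensor_apply t r n ?A1 x = tensor_apply t r n ?A1 y"
    proof
      fix i show "tensor_apply t r n ?A1 x i = tensor_apply t r n ?A1 y i"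
        using fun_cong[OF eq, of i] tensor_apply_row_block1[OF assms(1), of i t n A]
        by (cases "i \<in> {1..r}") (metis, simp only: tensor_apply_def restrict_apply if_False)
    qed
  next
    assume eq: "tensor_apply t r n ?A1 x = tensor_apply t r n ?A1 y"
    show "tensor_apply t m n A x = tensor_apply t m n A y"
    proof
      fix i
      consider "i \<in> {1..r}" | "i \<in> {1..m}" "r < i" | "i \<notin> {1..m}"
        by fastforce
      then show "tensor_apply t m n A x i = tensor_apply t m n A y i"
      proof cases
        case 1
        then show ?thesis
          using assms(1) eq by (simp only: tensor_apply_row_block1)
      next
        case 2
        then show ?thesis by (simp only: Ax0)
      next
        case 3
        then show ?thesis by (simp only: tensor_apply_def restrict_apply if_False)
      qed
    qed
  qed
  have "tensor_apply k n m X (root_vec rt m (tensor_apply t m n A y)) =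
      tensor_apply k n r ?X1 (root_vec rt r (tensor_apply t r n ?A1 y))" for y
  proof -
    let ?u = "root_vec rt m (tensor_apply t m n A y)"
    \<comment> \<open>A column index beyond r selects a component of \<open>?u\<close> that is a
      root of 0, so the monomial has a zero factor.\<close>
    have "tensor_apply k n m X ?u = tensor_apply k n r ?X1 ?u"
    proof (rule tensor_apply_col_block1[OF assms(1)])
      fix i js assume js: "js \<in> multi_idx (k - 1) m" "\<exists>j\<in>set js. r < j"
      then obtain l where l: "l < k - 1" "r < js ! l"
        by (auto simp: multi_idx_def in_set_conv_nth)
      then have "?u (js ! l) = 0"
        using multi_idx_nth[OF js(1) l(1)] Ax0[of "js ! l" y] by (simp add: root_vec_def rt0)
      then have "(\<Prod>l<k - 1. ?u (js ! l)) = 0"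
        using l(1) by (intro prod_zero) auto
      then show "X (i, js) * (\<Prod>l<k - 1. ?u (js ! l)) = 0"
        by simp
    qed
    \<comment> \<open>The root vectors have different lengths, but use the same branch
      \<open>rt i\<close> of the same number for each i \<le> r.\<close>
    also have "\<dots> = tensor_apply k n r ?X1 (root_vec rt r (tensor_apply t r n ?A1 y))"
      by (rule tensor_apply_cong)
        (use assms(1) in \<open>auto simp: root_vec_def tensor_apply_row_block1\<close>)
    finally show ?thesis .
  qed
  then show ?thesis
    using X by (simp add: one_inverses_iff eq_iff col_block1_tensors)
qed

text \<open>Here the root vectors lie in C^m on both sides; what changes is the range of y, C^n
  against C^r, and the length of the inner vector.\<close>

lemma one_inverses_zero_cols:
  assumes "r \<le> n" and zero: "col_block2 t m n r A = (\<lambda>p\<in>col_rest t m n r. 0)"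
    and X: "X \<in> tensors k n m"
  shows "X \<in> one_inverses rt k t m n A \<longleftrightarrow>
    row_block1 k m r X \<in> one_inverses rt k t m r (col_block1 t m r A)"
proof -
  let ?A1 = "col_block1 t m r A" and ?X1 = "row_block1 k m r X"
  have A_eq: "tensor_apply t m n A x = tensor_apply t m r ?A1 x" for x
  proof (rule tensor_apply_col_block1[OF assms(1)])
    fix i js assume "i \<in> {1..m}" "js \<in> multi_idx (t - 1) n" "\<exists>j\<in>set js. r < j"
    then have "(i, js) \<in> col_rest t m n r"
      by (simp add: col_rest_def tensor_idx_def)
    with fun_cong[OF zero, of "(i, js)"] have "A (i, js) = 0"
      by (simp add: col_block2_def)
    then show "A (i, js) * (\<Prod>l<t - 1. x (js ! l)) = 0"
      by simp
  qed
  have X_eq: "tensor_apply t m r ?A1 (tensor_apply k n m X u) =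
      tensor_apply t m r ?A1 (tensor_apply k r m ?X1 u)" for u
    using assms(1) by (intro tensor_apply_cong tensor_apply_row_block1) auto
  \<comment> \<open>The first block reads only the first r components of y. Restriction to
    \<open>{1..r}\<close> takes C^n to C^r; in the other direction y is restricted to
    \<open>{1..n}\<close>, and its values beyond r are never read.\<close>
  have ext: "(\<forall>y\<in>cvectors n. P (tensor_apply t m r ?A1 y)) \<longleftrightarrow>
      (\<forall>y\<in>cvectors r. P (tensor_apply t m r ?A1 y))" for P
  proof -
    have restr: "tensor_apply t m r ?A1 (restrict y {1..q}) = tensor_apply t m r ?A1 y"
      if "r \<le> q" for q y
      using that by (intro tensor_apply_cong) auto
    have mem: "restrict y {1..q} \<in> cvectors q" for q y
      by (simp add: cvectors_def)
    show ?thesis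
      using restr[OF order_refl] restr[OF assms(1)] mem by metis
  qed
  show ?thesis
    using X ext[of "\<lambda>b. tensor_apply t m r ?A1 (tensor_apply k r m ?X1 (root_vec rt m b)) = b"]
    by (simp add: one_inverses_iff A_eq X_eq row_block1_tensors)
qed

theorem theorem2p7:
  fixes t k m n r :: nat
    and A :: tensor
    and rt :: "nat \<Rightarrow> complex \<Rightarrow> complex"
  assumes "2 \<le> t" and "2 \<le> k" and "1 \<le> m" and "1 \<le> n" and "1 \<le> r"
    and "A \<in> tensors t m n"
    and "root_choice ((t - 1) * (k - 1)) rt"
  shows "(r \<le> m \<and> row_block2 t m n r A = (\<lambda>p\<in>row_rest t m n r. 0) \<longrightarrow>
            one_inverses rt k t m n A =
              {col_join k n m r W X | W X.
                 W \<in> one_inverses rt k t r n (row_block1 t n r A) \<and>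
                 X \<in> col_rest k n m r \<rightarrow>\<^sub>E UNIV}) \<and>
         (r \<le> n \<and> col_block2 t m n r A = (\<lambda>p\<in>col_rest t m n r. 0) \<longrightarrow>
            one_inverses rt k t m n A =
              {row_join k n m r W Y | W Y.
                 W \<in> one_inverses rt k t m r (col_block1 t m r A) \<and>
                 Y \<in> row_rest k n m r \<rightarrow>\<^sub>E UNIV})"
proof (intro conjI impI)
  assume *: "r \<le> m \<and> row_block2 t m n r A = (\<lambda>p\<in>row_rest t m n r. 0)"
  \<comment> \<open>Orders of at least 2 make the exponent (t - 1) * (k - 1) positive, so 0 is the
    only root of 0.\<close>
  have "rt i 0 = 0" for i
    using assms(1,2) by (intro root_choice_zero[OF assms(7)]) simp
  then have "one_inverses rt k t m n A =
      {X \<in> tensors k n m. col_block1 k n r X \<in> one_inverses rt k t r n (row_block1 t n r A)}"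
    using * one_inverses_zero_rows one_inverses_subset by blast
  then show "one_inverses rt k t m n A =
      {col_join k n m r W X | W X. W \<in> one_inverses rt k t r n (row_block1 t n r A) \<and>
         X \<in> col_rest k n m r \<rightarrow>\<^sub>E UNIV}"
    using * by (simp only: col_join_image one_inverses_subset)
next
  assume *: "r \<le> n \<and> col_block2 t m n r A = (\<lambda>p\<in>col_rest t m n r. 0)"
  then have "one_inverses rt k t m n A =
      {X \<in> tensors k n m. row_block1 k m r X \<in> one_inverses rt k t m r (col_block1 t m r A)}"
    using one_inverses_zero_cols one_inverses_subset by blast
  then show "one_inverses rt k t m n A =
      {row_join k n m r W Y | W Y. W \<in> one_inverses rt k t m r (col_block1 t m r A) \<and>
         Y \<in> row_rest k n m r \<rightarrow>\<^sub>E UNIV}"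
    using * by (simp only: row_join_image one_inverses_subset)
qed

end
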